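(* Let $G$ be a finite simple $r$-regular graph with $r$ even ($r \geq 2$). Then for all integers $p \geq 0$ and $q \geq 2$, \[ \alpha_p(G) \leq \alpha_q(L(G)). \]
   Context: For a graph $G$ and a non-negative integer $p$, a set $S \subseteq V(G)$ is $p$-independent if the subgraph induced by $S$ has maximum degree at most $p$; $\alpha_p(G)$ denotes the maximum cardinality of a $p$-independent set of $G$. $L(G)$ is the line graph of $G$. *)

theory Defs
  imports Main
begin

record 'a ugraph =
  verts :: "'a set"
  edges :: "'a set set"

definition finite_simple_graph :: "'a ugraph \<Rightarrow> bool" where
  "finite_simple_graph G \<longleftrightarrow>
     finite (verts G) \<and> (\<forall>e\<in>edges G. e \<subseteq> verts G \<and> card e = 2)"

definition degree :: "'a ugraph \<Rightarrow> 'a \<Rightarrow> nat" where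
  "degree G v = card {e \<in> edges G. v \<in> e}"

definition regular :: "nat \<Rightarrow> 'a ugraph \<Rightarrow> bool" where
  "regular r G \<longleftrightarrow> (\<forall>v\<in>verts G. degree G v = r)"

(* The 0 only matters for the graph without vertices, whose maximum degree is
   thereby 0; in particular the empty set is p-independent for every p. *)
definition max_degree :: "'a ugraph \<Rightarrow> nat" where
  "max_degree G = Max (insert 0 (degree G ` verts G))"

definition induced_subgraph :: "'a ugraph \<Rightarrow> 'a set \<Rightarrow> 'a ugraph" where
  "induced_subgraph G S = \<lparr>verts = S, edges = {e \<in> edges G. e \<subseteq> S}\<rparr>"

definition p_independent :: "nat \<Rightarrow> 'a ugraph \<Rightarrow> 'a set \<Rightarrow> bool" where
  "p_independent p G S \<longleftrightarrow> S \<subseteq> verts G \<and> max_degree (induced_subgraph G S) \<le> p"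

definition p_independence_number :: "nat \<Rightarrow> 'a ugraph \<Rightarrow> nat" where
  "p_independence_number p G = Max (card ` {S. p_independent p G S})"

definition line_graph :: "'a ugraph \<Rightarrow> 'a set ugraph" where
  "line_graph G =
     \<lparr>verts = edges G,
      edges = {{e, f} | e f. e \<in> edges G \<and> f \<in> edges G \<and> e \<noteq> f \<and> e \<inter> f \<noteq> {}}\<rparr>"

lemma finite_simple_graph_line_graph:
  assumes "finite_simple_graph G"
  shows "finite_simple_graph (line_graph G)"
proof -
  have "edges G \<subseteq> Pow (verts G)"
    using assms by (auto simp: finite_simple_graph_def)
  then have "finite (edges G)"
    using assms by (auto simp: finite_simple_graph_def intro: finite_subset)
  then show ?thesis
    unfolding finite_simple_graph_def line_graph_def by (fastforce simp: card_2_iff)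
qed

(* The maximum in p_independence_number is taken over a finite nonempty set. *)
lemma p_independent_sets:
  assumes "finite_simple_graph G"
  shows "finite {S. p_independent p G S}" and "p_independent p G {}"
proof -
  have "{S. p_independent p G S} \<subseteq> Pow (verts G)"
    by (auto simp: p_independent_def)
  then show "finite {S. p_independent p G S}"
    using assms by (auto simp: finite_simple_graph_def intro: finite_subset)
  show "p_independent p G {}"
    by (simp add: p_independent_def max_degree_def induced_subgraph_def)
qed

end

theory Submission
  imports Defs
begin

text \<open>
  The bound compares both sides with the number of vertices: a set of vertices of \<open>G\<close> has at most
  \<open>card (verts G)\<close> elements, while a 2-factor of \<open>G\<close> has exactly that many edges, each meeting
  only two others. A 2-factor exists by Petersen's argument: orient \<open>G\<close> so that in- and
  out-degrees agree, and apply Hall's theorem to the regular bipartite graph which joins the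
  out-copy of a vertex to the in-copies of its successors.
\<close>

section \<open>Hall's marriage theorem\<close>

text \<open>Induction on the total size of the sets: as long as some \<open>A i\<close> has two
  elements, one of them can be deleted without destroying Hall's condition. Once all sets are
  singletons, the condition for pairs of indices makes them distinct.\<close>

lemma Hall_marriage:
  fixes A :: "'i \<Rightarrow> 'b set"
  assumes "finite I" and "\<And>i. i \<in> I \<Longrightarrow> finite (A i)"
    and "\<And>J. J \<subseteq> I \<Longrightarrow> card J \<le> card (\<Union>(A ` J))"
  shows "\<exists>f. inj_on f I \<and> (\<forall>i\<in>I. f i \<in> A i)"
  using assms
proof (induction "\<Sum>i\<in>I. card (A i)" arbitrary: A rule: less_induct)
  case less
  note fin = less.prems(1,2) and Hall = less.prems(3)
  show ?case
  proof (cases "\<exists>i\<in>I. \<exists>x\<in>A i. \<exists>y\<in>A i. x \<noteq> y")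
    case False
    have "A i \<noteq> {}" if "i \<in> I" for i
      using Hall[of "{i}"] that by auto
    then have "\<forall>i\<in>I. \<exists>x. A i = {x}"
      using False by blast
    then obtain f where f: "\<And>i. i \<in> I \<Longrightarrow> A i = {f i}"
      by metis
    have "inj_on f I"
    proof (rule inj_onI, rule ccontr)
      fix i j assume "i \<in> I" "j \<in> I" "f i = f j" "i \<noteq> j"
      with Hall[of "{i, j}"] f show False by simp
    qed
    with f show ?thesis by auto
  next
    case True
    then obtain i x y where i: "i \<in> I" and xy: "x \<in> A i" "y \<in> A i" "x \<noteq> y"
      by blast
    have reduce: ?thesis
      if z: "z \<in> A i" and H: "\<And>J. J \<subseteq> I \<Longrightarrow> card J \<le> card (\<Union>((A(i := A i - {z})) ` J))" for z
    proof -
      let ?B = "A(i := A i - {z})"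
      have "card (A i - {z}) < card (A i)"
        using fin(2)[OF i] z by (rule card_Diff1_less)
      then have "(\<Sum>j\<in>I. card (?B j)) < (\<Sum>j\<in>I. card (A j))"
        using i fin(1) by (intro sum_strict_mono_ex1) (auto intro!: bexI[of _ i])
      moreover have "finite (?B j)" if "j \<in> I" for j
        using fin(2)[OF that] by auto
      ultimately obtain f where "inj_on f I" "\<forall>j\<in>I. f j \<in> ?B j"
        using less.hyps[OF _ fin(1) _ H] by blast
      then show ?thesis
        by (auto split: if_splits intro!: exI[of _ f])
    qed
    \<comment> \<open>A family that violates the condition after the deletion must contain
      \<open>i\<close>, since no other set has changed. Here \<open>J\<close> is that family without
      \<open>i\<close>, so the strict inequality weakens to \<le>.\<close>
    have violation: "\<exists>J. J \<subseteq> I - {i} \<and> card (\<Union>(A ` J) \<union> (A i - {z})) \<le> card J"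
      if z: "z \<in> A i" and no: "\<not> ?thesis" for z
    proof -
      let ?B = "A(i := A i - {z})"
      obtain J where J: "J \<subseteq> I" "card (\<Union>(?B ` J)) < card J"
        using reduce[OF z] no by (meson not_le)
      have "i \<in> J"
      proof (rule ccontr)
        assume "i \<notin> J"
        then have "?B ` J = A ` J" by auto
        with J(2) Hall[OF J(1)] show False by (metis not_le)
      qed
      then have "\<Union>(?B ` J) = \<Union>(A ` (J - {i})) \<union> (A i - {z})" by auto
      moreover have "card J = Suc (card (J - {i}))"
        using \<open>i \<in> J\<close> J(1) fin(1) by (metis card_Suc_Diff1 finite_subset)
      ultimately show ?thesis
        using J by (intro exI[of _ "J - {i}"]) auto
    qed
    show ?thesis
    proof (rule ccontr)
      assume no: "\<not> ?thesis"
      obtain J where J: "J \<subseteq> I - {i}" "card (\<Union>(A ` J) \<union> (A i - {x})) \<le> card J"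
        using violation[OF xy(1) no] by blast
      obtain K where K: "K \<subseteq> I - {i}" "card (\<Union>(A ` K) \<union> (A i - {y})) \<le> card K"
        using violation[OF xy(2) no] by blast
      let ?P = "\<Union>(A ` J) \<union> (A i - {x})" and ?Q = "\<Union>(A ` K) \<union> (A i - {y})"
      have finJK: "finite J" "finite K"
        using J(1) K(1) fin(1) by (auto intro: finite_subset)
      have finPQ: "finite ?P" "finite ?Q"
        using J(1) K(1) fin i finJK by auto
      have "Suc (card (J \<union> K)) = card (insert i (J \<union> K))"
        using J(1) K(1) finJK by (subst card_insert_disjoint) auto
      also have "\<dots> \<le> card (\<Union>(A ` insert i (J \<union> K)))"
        using J(1) K(1) i by (intro Hall) auto
      \<comment> \<open>As \<open>x\<close> and \<open>y\<close> differ, the two truncated copies of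
        \<open>A i\<close> together cover \<open>A i\<close>.\<close>
      also have "\<dots> \<le> card (?P \<union> ?Q)"
        using finPQ xy by (intro card_mono) auto
      finally have un: "Suc (card (J \<union> K)) \<le> card (?P \<union> ?Q)" .
      have "card (J \<inter> K) \<le> card (\<Union>(A ` (J \<inter> K)))"
        using J(1) by (intro Hall) auto
      also have "\<dots> \<le> card (?P \<inter> ?Q)"
        using finPQ by (intro card_mono) auto
      \<comment> \<open>The cardinalities of union and intersection add up to
        \<open>card ?P + card ?Q\<close>, hence to at most \<open>card J + card K\<close>, but the
        two lower bounds add up to one more.\<close>
      finally show False
        using un J(2) K(2) card_Un_Int[OF finPQ] card_Un_Int[OF finJK] by linarith
    qed
  qed
qed

section \<open>Balanced orientations\<close>

text \<open>
  Multigraphs are given by an index set \<open>I\<close> of edges with end points \<open>s i\<close> and \<open>t i\<close>; loops and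
  parallel edges are needed in the induction, which splits off a pair of edges \<open>u - v - w\<close> into a
  single edge \<open>u - w\<close>.
\<close>

lemma balanced_orientation:
  fixes s t :: "'i \<Rightarrow> 'a"
  assumes "finite I"
    and "\<And>v. even (card {i\<in>I. s i = v} + card {i\<in>I. t i = v})"
  shows "\<exists>s' t'. (\<forall>i\<in>I. s' i = s i \<and> t' i = t i \<or> s' i = t i \<and> t' i = s i) \<and>
    (\<forall>v. card {i\<in>I. s' i = v} = card {i\<in>I. t' i = v})"
proof -
  \<comment> \<open>Sums of indicators make the removal or change of a single edge plain
    arithmetic.\<close>
  have card_eq: "card {i\<in>I. P i} = (\<Sum>i\<in>I. of_bool (P i))" if "finite I" for P and I :: "'i set"
    using that by (simp add: sum.If_cases of_bool_def Int_def)
  have "\<exists>s' t'. (\<forall>i\<in>I. s' i = s i \<and> t' i = t i \<or> s' i = t i \<and> t' i = s i) \<and>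
    (\<forall>v. (\<Sum>i\<in>I. of_bool (s' i = v)) = (\<Sum>i\<in>I. of_bool (t' i = v) :: nat))"
    if "finite I" "\<And>v. even (\<Sum>i\<in>I. of_bool (s i = v) + of_bool (t i = v) :: nat)" for I
    using that
  proof (induction I arbitrary: s t rule: finite_psubset_induct)
    case (psubset I)
    let ?d = "\<lambda>v i. of_bool (s i = v) + of_bool (t i = v) :: nat"
    show ?case
    proof (cases "\<exists>i\<in>I. s i \<noteq> t i")
      \<comment> \<open>Only loops are left, and a loop adds one to both degrees of its
        vertex.\<close>
      case False
      then show ?thesis
        by (intro exI[of _ s] exI[of _ t]) (auto intro: sum.cong)
    next
      case True
      then obtain i where i: "i \<in> I" "s i \<noteq> t i" by blast
      \<comment> \<open>The degree of \<open>t i\<close> is even and the non-loop \<open>i\<close>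
        contributes exactly 1 to it, so another edge meets \<open>t i\<close>.\<close>
      have "\<exists>j\<in>I - {i}. s j = t i \<or> t j = t i"
      proof (rule ccontr)
        assume "\<not> ?thesis"
        then have "(\<Sum>j\<in>I - {i}. ?d (t i) j) = 0" by auto
        then have "(\<Sum>j\<in>I. ?d (t i) j) = 1"
          using i psubset.hyps by (simp add: sum.remove[of I i])
        then show False
          using psubset.prems[of "t i"] by simp
      qed
      then obtain j where j: "j \<in> I" "j \<noteq> i" "s j = t i \<or> t j = t i" by blast
      \<comment> \<open>The other end of \<open>j\<close>, which is \<open>t i\<close> itself if
        \<open>j\<close> is a loop. Edge \<open>i\<close> now runs between \<open>s i\<close> and
        \<open>w\<close>, and \<open>j\<close> is dropped; only the degree of \<open>t i\<close>
        changes, by 2.\<close>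
      define w where "w = (if s j = t i then t j else s j)"
      let ?I = "I - {i, j}" and ?t = "t(i := w)"
      have split': "(\<Sum>k\<in>I - {j}. g k) = g i + (\<Sum>k\<in>?I. g k)" for g :: "'i \<Rightarrow> nat"
      proof -
        have "I - {j} - {i} = ?I" by blast
        then show ?thesis
          using sum.remove[of "I - {j}" i g] i j psubset.hyps by simp
      qed
      have split: "(\<Sum>k\<in>I. g k) = g i + g j + (\<Sum>k\<in>?I. g k)" for g :: "'i \<Rightarrow> nat"
        unfolding sum.remove[OF psubset.hyps j(1), of g] split' by (simp only: ac_simps)
      have same: "(\<Sum>k\<in>?I. g k (?t k)) = (\<Sum>k\<in>?I. g k (t k))" for g :: "'i \<Rightarrow> 'a \<Rightarrow> nat"
        by (intro sum.cong) auto
      have "even (\<Sum>k\<in>I - {j}. of_bool (s k = v) + of_bool (?t k = v) :: nat)" for v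
      proof -
        have "(\<Sum>k\<in>I. ?d v k) =
          (\<Sum>k\<in>I - {j}. of_bool (s k = v) + of_bool (?t k = v)) + 2 * of_bool (t i = v)"
          unfolding split split' same[of "\<lambda>k x. of_bool (s k = v) + of_bool (x = v)"]
          using j by (auto simp: w_def)
        then show ?thesis
          using psubset.prems[of v] by simp
      qed
      with psubset.IH[of "I - {j}" s ?t] j obtain s' t' where
        or: "\<And>k. k \<in> I - {j} \<Longrightarrow> s' k = s k \<and> t' k = ?t k \<or> s' k = ?t k \<and> t' k = s k" and
        bal: "\<And>v. (\<Sum>k\<in>I - {j}. of_bool (s' k = v)) = (\<Sum>k\<in>I - {j}. of_bool (t' k = v) :: nat)"
        by blast
      \<comment> \<open>The oriented edge between \<open>s i\<close> and \<open>w\<close> is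
        expanded into a directed path through \<open>t i\<close>, in the same direction. The path
        enters and leaves \<open>t i\<close> once, so balance persists.\<close>
      define s'' t'' where
        "s'' = (if s' i = s i \<and> t' i = w then s'(i := s i, j := t i) else s'(i := t i, j := w))" and
        "t'' = (if s' i = s i \<and> t' i = w then t'(i := t i, j := w) else t'(i := s i, j := t i))"
      have or_i: "s' i = s i \<and> t' i = w \<or> s' i = w \<and> t' i = s i"
        using or[of i] i j by auto
      have "s'' k = s k \<and> t'' k = t k \<or> s'' k = t k \<and> t'' k = s k" if k: "k \<in> I" for k
      proof -
        consider "k = i" | "k = j" | "k \<in> I - {j}" "k \<noteq> i" "k \<noteq> j" using k by blast
        then show ?thesis
        proof cases
          case 1
          then show ?thesis using j(2) by (simp add: s''_def t''_def)
        next
          case 2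
          then show ?thesis using j(3) by (simp add: s''_def t''_def w_def) metis
        next
          case 3
          then show ?thesis using or[of k] by (simp add: s''_def t''_def)
        qed
      qed
      moreover have "(\<Sum>k\<in>I. of_bool (s'' k = v)) = (\<Sum>k\<in>I. of_bool (t'' k = v) :: nat)" for v
      proof -
        have "(\<Sum>k\<in>?I. of_bool (s'' k = v)) = (\<Sum>k\<in>?I. of_bool (s' k = v) :: nat)"
          "(\<Sum>k\<in>?I. of_bool (t'' k = v)) = (\<Sum>k\<in>?I. of_bool (t' k = v) :: nat)"
          by (auto simp: s''_def t''_def intro!: sum.cong)
        then show ?thesis
          using bal[of v] or_i j(2) unfolding split split'
          by (cases "s' i = s i \<and> t' i = w") (simp_all add: s''_def t''_def)
      qed
      ultimately show ?thesis by blast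
    qed
  qed
  from this[OF assms(1)] assms show ?thesis
    by (simp add: card_eq sum.distrib)
qed

section \<open>Factors of regular graphs\<close>

text \<open>The \<open>k * card J\<close> edges leaving \<open>J\<close> all enter the set of its
  successors, each of which receives only \<open>k\<close> edges; cancelling \<open>k\<close> yields
  Hall's condition.\<close>

lemma regular_digraph_1_factor:
  fixes s t :: "'i \<Rightarrow> 'a"
  assumes "finite E" "finite V" "k > 0" "t ` E \<subseteq> V"
    and out: "\<And>v. v \<in> V \<Longrightarrow> card {e\<in>E. s e = v} = k"
    and inn: "\<And>v. v \<in> V \<Longrightarrow> card {e\<in>E. t e = v} = k"
  shows "\<exists>F\<subseteq>E. card F = card V \<and> inj_on s F \<and> inj_on t F"
proof -
  let ?A = "\<lambda>v. t ` {e\<in>E. s e = v}"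
  have fibres: "card {e\<in>E. g e \<in> W} = k * card W"
    if "W \<subseteq> V" "\<And>v. v \<in> V \<Longrightarrow> card {e\<in>E. g e = v} = k" for g :: "'i \<Rightarrow> 'a" and W
  proof -
    have "{e\<in>E. g e \<in> W} = (\<Union>v\<in>W. {e\<in>E. g e = v})" by auto
    also have "card \<dots> = (\<Sum>v\<in>W. card {e\<in>E. g e = v})"
      using that assms(1,2) by (intro card_UN_disjoint) (auto intro: finite_subset)
    also have "\<dots> = (\<Sum>v\<in>W. k)"
      using that by (intro sum.cong) auto
    finally show ?thesis by simp
  qed
  have "\<exists>f. inj_on f V \<and> (\<forall>v\<in>V. f v \<in> ?A v)"
  proof (rule Hall_marriage)
    fix J assume J: "J \<subseteq> V"
    have "k * card J = card {e\<in>E. s e \<in> J}"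
      using fibres[OF J out] by simp
    also have "\<dots> \<le> card {e\<in>E. t e \<in> \<Union>(?A ` J)}"
      using assms(1) by (intro card_mono) auto
    also have "\<dots> = k * card (\<Union>(?A ` J))"
      using assms(4) by (intro fibres inn) auto
    finally show "card J \<le> card (\<Union>(?A ` J))"
      using assms(3) by simp
  qed (use assms in auto)
  then obtain f where f: "inj_on f V" "\<forall>v\<in>V. \<exists>e. e \<in> E \<and> s e = v \<and> t e = f v"
    by (auto simp: image_iff) metis
  then obtain h where h: "\<And>v. v \<in> V \<Longrightarrow> h v \<in> E \<and> s (h v) = v \<and> t (h v) = f v"
    by metis
  have "inj_on h V"
    using h by (metis inj_onI)
  moreover have "inj_on s (h ` V)" "inj_on t (h ` V)"
    using h f(1) by (auto simp: inj_on_def)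
  ultimately show ?thesis
    using h by (intro exI[of _ "h ` V"]) (auto simp: card_image)
qed

text \<open>The 2-factor comes with an orientation: by the cardinality of \<open>F\<close>,
  injectivity makes every vertex the tail of exactly one edge and the head of exactly one.\<close>

lemma Petersen_2_factor:
  assumes G: "finite_simple_graph G" and "regular r G" "even r" "r > 0"
  shows "\<exists>F s t. F \<subseteq> edges G \<and> card F = card (verts G) \<and> (\<forall>e\<in>F. {s e, t e} = e) \<and>
    inj_on s F \<and> inj_on t F"
proof -
  let ?E = "edges G" and ?V = "verts G"
  have sub: "e \<subseteq> ?V" if "e \<in> ?E" for e
    using G that by (auto simp: finite_simple_graph_def)
  have finV: "finite ?V"
    using G by (simp add: finite_simple_graph_def)
  then have finE: "finite ?E"
    using sub by (intro finite_subset[of ?E "Pow ?V"]) auto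
  have "\<forall>e\<in>?E. \<exists>x y. {x, y} = e \<and> x \<noteq> y"
    using G unfolding finite_simple_graph_def card_2_iff by metis
  then obtain a b where ab: "\<And>e. e \<in> ?E \<Longrightarrow> {a e, b e} = e \<and> a e \<noteq> b e"
    by metis
  have deg: "degree G v = card {e\<in>?E. s e = v} + card {e\<in>?E. t e = v}"
    if st: "\<And>e. e \<in> ?E \<Longrightarrow> {s e, t e} = e \<and> s e \<noteq> t e" for s t v
  proof -
    have "v \<in> e \<longleftrightarrow> s e = v \<or> t e = v" if "e \<in> ?E" for e
      using st[OF that] by (metis insert_iff singletonD)
    then have "{e\<in>?E. v \<in> e} = {e\<in>?E. s e = v} \<union> {e\<in>?E. t e = v}"
      by blast
    moreover have "{e\<in>?E. s e = v} \<inter> {e\<in>?E. t e = v} = {}"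
      by (auto dest: conjunct2[OF st])
    ultimately show ?thesis
      unfolding degree_def using finE by (simp add: card_Un_disjoint)
  qed
  \<comment> \<open>Parity is required at every element of the type; outside \<open>verts G\<close>
    the degree is 0.\<close>
  have "even (degree G v)" for v
  proof (cases "v \<in> ?V")
    case False
    then have "{e\<in>?E. v \<in> e} = {}" using sub by auto
    then show ?thesis by (simp only: degree_def) simp
  qed (use assms in \<open>simp add: regular_def\<close>)
  then have "even (card {e\<in>?E. a e = v} + card {e\<in>?E. b e = v})" for v
    using deg[of a b v, OF ab] by metis
  from balanced_orientation[OF finE this]
  obtain s t where st: "\<And>e. e \<in> ?E \<Longrightarrow> s e = a e \<and> t e = b e \<or> s e = b e \<and> t e = a e"
    and bal: "\<And>v. card {e\<in>?E. s e = v} = card {e\<in>?E. t e = v}"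
    by blast
  have ends: "{s e, t e} = e \<and> s e \<noteq> t e" if "e \<in> ?E" for e
    using ab[OF that] st[OF that] by (metis insert_commute)
  have half: "card {e\<in>?E. t e = v} = r div 2" if "v \<in> ?V" for v
    using deg[of s t v, OF ends] bal[of v] that assms(2) by (simp add: regular_def)
  have "\<exists>F\<subseteq>?E. card F = card ?V \<and> inj_on s F \<and> inj_on t F"
  proof (rule regular_digraph_1_factor[OF finE finV, of "r div 2"])
    show "t ` ?E \<subseteq> ?V"
      using ends sub by blast
  qed (use assms half bal in auto)
  with ends show ?thesis by blast
qed

section \<open>Comparison of the independence numbers\<close>

lemma p_independence_number_le_card:
  assumes "finite_simple_graph G"
  shows "p_independence_number p G \<le> card (verts G)"
  unfolding p_independence_number_def
proof (rule Max.boundedI)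
  show "finite (card ` {S. p_independent p G S})"
    using p_independent_sets(1)[OF assms] by (rule finite_imageI)
  show "card ` {S. p_independent p G S} \<noteq> {}"
    using p_independent_sets(2)[OF assms] by blast
qed (use assms in \<open>auto simp: p_independent_def finite_simple_graph_def intro: card_mono\<close>)

lemma card_le_p_independence_number:
  assumes "finite_simple_graph G" "p_independent p G S"
  shows "card S \<le> p_independence_number p G"
  unfolding p_independence_number_def
  using assms p_independent_sets(1)[OF assms(1), of p] by (intro Max_ge) auto

text \<open>Distinct edges of \<open>F\<close> share neither their tails nor their heads, so they
  can only meet where the head of one is the tail of the other. Each edge thus has at most one
  neighbour at either end.\<close>

lemma p_independent_line_graph_2_factor:
  assumes G: "finite_simple_graph G" and F: "F \<subseteq> edges G"
    and ends: "\<And>e. e \<in> F \<Longrightarrow> {s e, t e} = e" and inj: "inj_on s F" "inj_on t F"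
  shows "p_independent 2 (line_graph G) F"
proof -
  let ?H = "induced_subgraph (line_graph G) F"
  have "finite (edges G)"
    using G finite_simple_graph_line_graph[OF G]
    by (simp add: finite_simple_graph_def line_graph_def)
  then have finF: "finite F"
    using F by (rule finite_subset[rotated])
  have fibre: "card {f\<in>F. g f = v} \<le> 1" if "inj_on g F" for g :: "'a set \<Rightarrow> 'a" and v
    using that finF by (auto simp: card_le_Suc0_iff_eq inj_on_def)
  have "degree ?H e \<le> 2" if e: "e \<in> F" for e
  proof -
    let ?N = "{f\<in>F. s f = t e} \<union> {f\<in>F. t f = s e}"
    have "{x\<in>edges ?H. e \<in> x} \<subseteq> (\<lambda>f. {e, f}) ` ?N"
    proof
      fix x assume "x \<in> {x\<in>edges ?H. e \<in> x}"
      then obtain f where f: "x = {e, f}" "f \<in> F" "f \<noteq> e" "e \<inter> f \<noteq> {}"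
        by (auto simp: induced_subgraph_def line_graph_def insert_commute)
      then have "s f \<noteq> s e" "t f \<noteq> t e"
        using inj e by (auto dest: inj_onD)
      moreover obtain v where "v \<in> {s e, t e}" "v \<in> {s f, t f}"
        using f(4) ends[OF e] ends[OF f(2)] by (metis all_not_in_conv Int_iff)
      ultimately have "f \<in> ?N"
        using f(2) by auto
      with f(1) show "x \<in> (\<lambda>f. {e, f}) ` ?N" by blast
    qed
    then have "degree ?H e \<le> card ?N"
      unfolding degree_def using finF by (intro surj_card_le) auto
    also have "\<dots> \<le> 1 + 1"
      using fibre[OF inj(1)] fibre[OF inj(2)] by (intro order.trans[OF card_Un_le] add_mono)
    finally show ?thesis by simp
  qed
  then have "max_degree ?H \<le> 2"
    using finF by (simp add: max_degree_def induced_subgraph_def)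
  then show ?thesis
    using F by (simp add: p_independent_def line_graph_def)
qed

theorem theorem8:
  fixes G :: "'a ugraph" and r p q :: nat
  assumes "finite_simple_graph G"
    and "regular r G"
    and "even r"
    and "r \<ge> 2"
    and "q \<ge> 2"
  shows "p_independence_number p G \<le> p_independence_number q (line_graph G)"
proof -
  obtain F s t where F: "F \<subseteq> edges G" "card F = card (verts G)" "\<forall>e\<in>F. {s e, t e} = e"
    "inj_on s F" "inj_on t F"
    using Petersen_2_factor[OF assms(1-3)] assms(4) by auto
  have "p_independent 2 (line_graph G) F"
    using F by (intro p_independent_line_graph_2_factor[OF assms(1), of F s t]) auto
  then have "p_independent q (line_graph G) F"
    using assms(5) by (simp add: p_independent_def)
  then have "card (verts G) \<le> p_independence_number q (line_graph G)"
    using card_le_p_independence_number[OF finite_simple_graph_line_graph[OF assms(1)]] F(2)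
    by metis
  with p_independence_number_le_card[OF assms(1)] show ?thesis
    by (rule order.trans)
qed

end
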